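(* Let $S$ be a semiring, $M$ a nonzero $S$-semimodule and $G$ a cancellative torsion-free commutative monoid. Then the $S[G]$-semimodule $M[G]$ has very few zero-divisors if and only if the $S$-semimodule $M$ has very few zero-divisors.
   Context: A semiring is a set $S$ with operations $+,\cdot$ such that $(S,+)$ is a commutative monoid with identity $0$, $(S,\cdot)$ is a commutative monoid with identity $1\neq 0$, multiplication distributes over addition, and $s\cdot 0=0$ for all $s\in S$. An $S$-semimodule is a commutative monoid $(M,+,0)$ with a scalar multiplication $S\times M\to M$ satisfying the usual module axioms together with $0_S\cdot m=0_M=s\cdot 0_M$ and $1\cdot m=m$. A commutative monoid $G$ (written additively) is cancellative if $a+b=a+c$ implies $b=c$, and torsion-free if $na=nb$ with $n\geq 1$ implies $a=b$. $S[G]$ is the monoid semiring (finite formal sums $\sum s_iX^{g_i}$ with $X^gX^h=X^{g+h}$), and $M[G]$ is the set of finite formal sums $\sum m_iX^{g_i}$, $m_i\in M$, an $S[G]$-semimodule via $(sX^g)(mX^h)=(sm)X^{g+h}$. An ideal of $S$ is a nonempty subset closed under addition and under multiplication by elements of $S$; a proper ideal $\mathbf p$ is prime if $ab\in\mathbf p$ implies $a\in\mathbf p$ or $b\in\mathbf p$. For a nonzero $S$-semimodule $M$, $Z_S(M)$ is the set of $s\in S$ such that $sm=0$ for some nonzero $m\in M$. For $m \in M$, $\mathrm{Ann}(m)=\{s\in S: sm=0\}$. $\mathrm{Ass}_S(M)$ is the set of prime ideals of $S$ of the form $\mathrm{Ann}(m)$, $m\in M$. $M$ has very few zero-divisors if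 $Z_S(M)$ is a finite union of prime ideals in $\mathrm{Ass}_S(M)$. *)

theory Defs
  imports "HOL-Library.Poly_Mapping"
begin

text \<open>
  The class \<^class>\<open>comm_semiring_1\<close> is exactly the notion of semiring used here: addition
  and multiplication are commutative, zero is absorbing, and zero and one are distinct.  No
  library notion of module or ideal applies, since those require additive inverses.
\<close>

locale semimodule =
  fixes smul :: "'s::comm_semiring_1 \<Rightarrow> 'm::comm_monoid_add \<Rightarrow> 'm"
  assumes smul_add_right: "smul s (m + n) = smul s m + smul s n"
    and smul_add_left: "smul (s + t) m = smul s m + smul t m"
    and smul_mult: "smul (s * t) m = smul s (smul t m)"
    and smul_one: "smul 1 m = m"
    and smul_zero_left: "smul 0 m = 0"
    and smul_zero_right: "smul s 0 = 0"

definition semiring_ideal :: "'s::comm_semiring_1 set \<Rightarrow> bool" where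
  "semiring_ideal I \<longleftrightarrow>
     I \<noteq> {} \<and> (\<forall>a\<in>I. \<forall>b\<in>I. a + b \<in> I) \<and> (\<forall>s. \<forall>a\<in>I. s * a \<in> I)"

definition semiring_prime_ideal :: "'s::comm_semiring_1 set \<Rightarrow> bool" where
  "semiring_prime_ideal P \<longleftrightarrow>
     semiring_ideal P \<and> P \<noteq> UNIV \<and> (\<forall>a b. a * b \<in> P \<longrightarrow> a \<in> P \<or> b \<in> P)"

definition zero_divisors :: "('s::comm_semiring_1 \<Rightarrow> 'm::comm_monoid_add \<Rightarrow> 'm) \<Rightarrow> 's set" where
  "zero_divisors smul = {s. \<exists>m. m \<noteq> 0 \<and> smul s m = 0}"

definition Ann :: "('s::comm_semiring_1 \<Rightarrow> 'm::comm_monoid_add \<Rightarrow> 'm) \<Rightarrow> 'm \<Rightarrow> 's set" where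
  "Ann smul m = {s. smul s m = 0}"

definition Ass :: "('s::comm_semiring_1 \<Rightarrow> 'm::comm_monoid_add \<Rightarrow> 'm) \<Rightarrow> 's set set" where
  "Ass smul = {P. semiring_prime_ideal P \<and> (\<exists>m. P = Ann smul m)}"

definition very_few_zero_divisors ::
    "('s::comm_semiring_1 \<Rightarrow> 'm::comm_monoid_add \<Rightarrow> 'm) \<Rightarrow> bool" where
  "very_few_zero_divisors smul \<longleftrightarrow>
     (\<exists>\<P>. finite \<P> \<and> \<P> \<subseteq> Ass smul \<and> zero_divisors smul = \<Union>\<P>)"

text \<open>
  Cancellativity is stated explicitly because the class \<^class>\<open>cancel_comm_monoid_add\<close>
  also postulates a subtraction operation, which a cancellative monoid need not come with.
\<close>

definition cancellative_monoid :: "'g::comm_monoid_add itself \<Rightarrow> bool" where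
  "cancellative_monoid _ \<longleftrightarrow> (\<forall>a b c :: 'g. a + b = a + c \<longrightarrow> b = c)"

text \<open>The multiple of \<open>a\<close> by the natural number \<open>n\<close> is written as a sum of \<open>n\<close> copies of \<open>a\<close>.\<close>

definition torsion_free_monoid :: "'g::comm_monoid_add itself \<Rightarrow> bool" where
  "torsion_free_monoid _ \<longleftrightarrow>
     (\<forall>(n::nat) (a::'g) b. n \<ge> 1 \<and> (\<Sum>i<n. a) = (\<Sum>i<n. b) \<longrightarrow> a = b)"

text \<open>
  The monoid semiring of \<open>'g\<close> over \<open>'s\<close> is the type \<open>'g \<Rightarrow>\<^sub>0 's\<close> of finitely supported functions
  with its convolution product, where \<^const>\<open>Poly_Mapping.single\<close> yields the monomials, and
  formal sums with coefficients in \<open>'m\<close> form the type \<open>'g \<Rightarrow>\<^sub>0 'm\<close>.  The following is the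
  biadditive extension of the rule in \<open>monoid_smul_single\<close> below.
\<close>

definition monoid_smul ::
    "('s::comm_semiring_1 \<Rightarrow> 'm::comm_monoid_add \<Rightarrow> 'm) \<Rightarrow>
     ('g::comm_monoid_add \<Rightarrow>\<^sub>0 's) \<Rightarrow> ('g \<Rightarrow>\<^sub>0 'm) \<Rightarrow> ('g \<Rightarrow>\<^sub>0 'm)" where
  "monoid_smul smul f u =
     (\<Sum>g\<in>Poly_Mapping.keys f. \<Sum>h\<in>Poly_Mapping.keys u.
        Poly_Mapping.single (g + h) (smul (Poly_Mapping.lookup f g) (Poly_Mapping.lookup u h)))"

lemma poly_mapping_sum_single:
  fixes f :: "'a \<Rightarrow>\<^sub>0 'b::comm_monoid_add"
  shows "(\<Sum>g\<in>Poly_Mapping.keys f. Poly_Mapping.single g (Poly_Mapping.lookup f g)) = f"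
proof (rule poly_mapping_eqI)
  fix k
  have "Poly_Mapping.lookup (\<Sum>g\<in>Poly_Mapping.keys f. Poly_Mapping.single g (Poly_Mapping.lookup f g)) k =
      (\<Sum>g\<in>Poly_Mapping.keys f. if g = k then Poly_Mapping.lookup f g else 0)"
    by (auto simp: lookup_sum lookup_single when_def intro!: sum.cong)
  also have "\<dots> = Poly_Mapping.lookup f k"
    by (simp add: in_keys_iff)
  finally show "Poly_Mapping.lookup (\<Sum>g\<in>Poly_Mapping.keys f. Poly_Mapping.single g (Poly_Mapping.lookup f g)) k = Poly_Mapping.lookup f k" .
qed

lemma poly_mapping_additive_induct [case_names zero single add]:
  fixes f :: "'a \<Rightarrow>\<^sub>0 'b::comm_monoid_add"
  assumes "P 0" and "\<And>g c. P (Poly_Mapping.single g c)"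
    and "\<And>f f'. P f \<Longrightarrow> P f' \<Longrightarrow> P (f + f')"
  shows "P f"
proof -
  have "P (\<Sum>g\<in>A. Poly_Mapping.single g (Poly_Mapping.lookup f g))" if "finite A" for A
    using that by (induction A) (auto intro: assms)
  then show ?thesis
    using poly_mapping_sum_single[of f] finite_keys[of f] by metis
qed

context semimodule
begin

lemma monoid_smul_single:
  "monoid_smul smul (Poly_Mapping.single g s) (Poly_Mapping.single h m) =
     Poly_Mapping.single (g + h) (smul s m)"
  by (simp add: monoid_smul_def smul_zero_left smul_zero_right)

lemma monoid_smul_add_left:
  "monoid_smul smul (f + f') u = monoid_smul smul f u + monoid_smul smul f' u"
  unfolding monoid_smul_def
  by (rule setsum_keys_plus_distrib)
     (simp_all add: smul_zero_left smul_add_left single_add sum.distrib)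

lemma monoid_smul_add_right:
  "monoid_smul smul f (u + v) = monoid_smul smul f u + monoid_smul smul f v"
  unfolding monoid_smul_def sum.distrib [symmetric]
  by (rule sum.cong [OF refl], rule setsum_keys_plus_distrib)
     (simp_all add: smul_zero_right smul_add_right single_add)

lemma monoid_smul_zero: "monoid_smul smul 0 u = 0" "monoid_smul smul f 0 = 0"
  by (simp_all add: monoid_smul_def)

lemma monoid_smul_mult:
  "monoid_smul smul (f * f') u = monoid_smul smul f (monoid_smul smul f' u)"
proof (induction f rule: poly_mapping_additive_induct)
  case (single g s)
  show ?case
  proof (induction f' rule: poly_mapping_additive_induct)
    case (single g' t)
    show ?case
    proof (induction u rule: poly_mapping_additive_induct)
      case (single h m)
      show ?case
        by (simp add: mult_single monoid_smul_single smul_mult add.assoc)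
    qed (simp_all add: monoid_smul_zero monoid_smul_add_right)
  qed (simp_all add: monoid_smul_zero monoid_smul_add_left monoid_smul_add_right distrib_left)
qed (simp_all add: monoid_smul_zero monoid_smul_add_left distrib_right)

lemma monoid_smul_one: "monoid_smul smul 1 u = u"
proof (induction u rule: poly_mapping_additive_induct)
  case (single h m)
  show ?case
    using monoid_smul_single[of 0 1 h m] by (simp add: smul_one)
qed (simp_all add: monoid_smul_zero monoid_smul_add_right)

lemma semimodule_monoid_smul: "semimodule (monoid_smul smul)"
  by unfold_locales
     (simp_all add: monoid_smul_zero monoid_smul_add_left monoid_smul_add_right
        monoid_smul_mult monoid_smul_one)

end

end

theory Submission
  imports Defs
begin

text \<open>
  In a cancellative torsion-free commutative monoid every nonempty finite set has an extreme point,
  that is, a point which is not a proper convex combination of points of the set.  If \<open>a + b\<close> is an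
  extreme point of \<open>A + B\<close> and \<open>a + b = a' + b'\<close>, then \<open>2 (a + b) = (a + b') + (a' + b)\<close> forces
  \<open>a = a'\<close> and \<open>b = b'\<close>: some element of \<open>A + B\<close> is a sum in exactly one way.  This replaces the
  usual total order on the monoid and singles out a coefficient of a product that consists of one
  term only.  It follows that \<open>P[G]\<close> is prime whenever the annihilator \<open>P = Ann m\<close> is, and that the
  coefficients of a zero divisor on \<open>M[G]\<close> annihilate a common nonzero element of \<open>M\<close> (McCoy).
  Prime avoidance places this annihilator inside one of the primes covering \<open>Z(M)\<close>.  Conversely,
  the contraction to \<open>S\<close> of an associated prime \<open>Ann u\<close> of \<open>M[G]\<close> is the intersection of the
  annihilators of the finitely many coefficients of \<open>u\<close>, hence equal to one of them.
\<close>

section \<open>Sums that are attained only once\<close>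

definition nmul :: "nat \<Rightarrow> 'g::comm_monoid_add \<Rightarrow> 'g" where
  "nmul n a = (\<Sum>i<n. a)"

lemma nmul_0 [simp]: "nmul 0 a = 0"
  and nmul_Suc [simp]: "nmul (Suc n) a = a + nmul n a"
  by (simp_all add: nmul_def add.commute)

lemma nmul_add_left: "nmul (m + n) a = nmul m a + nmul n a"
  by (induction m) (simp_all add: add.assoc)

lemma nmul_add_right: "nmul n (a + b) = nmul n a + nmul n b"
  by (simp add: nmul_def sum.distrib)

lemma nmul_mult: "nmul (m * n) a = nmul m (nmul n a)"
  by (induction m) (simp_all add: nmul_add_left)

lemma nmul_sum: "nmul n (\<Sum>x\<in>A. f x) = (\<Sum>x\<in>A. nmul n (f x))"
  by (simp add: nmul_def sum.swap[of _ A])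

text \<open>Rational weights \<open>k x / n\<close> with denominators cleared, so that the notion
  makes sense in a monoid. For finite \<open>C\<close> the degenerate case \<open>n = 0\<close> only
  admits zero weights.\<close>

definition convex_combination :: "'g::comm_monoid_add set \<Rightarrow> nat \<Rightarrow> ('g \<Rightarrow> nat) \<Rightarrow> 'g \<Rightarrow> bool" where
  "convex_combination C n k c \<longleftrightarrow> (\<Sum>x\<in>C. k x) = n \<and> (\<Sum>x\<in>C. nmul (k x) x) = nmul n c"

definition extreme_point :: "'g::comm_monoid_add set \<Rightarrow> 'g \<Rightarrow> bool" where
  "extreme_point C c \<longleftrightarrow> c \<in> C \<and> (\<forall>n k. convex_combination C n k c \<longrightarrow> (\<forall>x\<in>C - {c}. k x = 0))"

text \<open>Any combination using \<open>z\<close> can be rewritten over \<open>C\<close> by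
  substituting the combination that represents \<open>z\<close>, and extremeness in \<open>C\<close>
  then applies.\<close>

lemma extreme_point_insert:
  fixes C :: "'g::comm_monoid_add set"
  assumes tf: "torsion_free_monoid TYPE('g)" and "finite C" and z: "z \<notin> C"
    and c: "extreme_point C c" and kz: "convex_combination C n k z" and n: "n \<ge> 1"
  shows "extreme_point (insert z C) c"
  unfolding extreme_point_def
proof (intro conjI allI impI)
  show "c \<in> insert z C" using c by (simp add: extreme_point_def)
  fix N j assume "convex_combination (insert z C) N j c"
  then have N: "j z + (\<Sum>x\<in>C. j x) = N" "nmul (j z) z + (\<Sum>x\<in>C. nmul (j x) x) = nmul N c"
    using \<open>finite C\<close> z by (simp_all add: convex_combination_def)
  have kn: "(\<Sum>x\<in>C. k x) = n" "(\<Sum>x\<in>C. nmul (k x) x) = nmul n z"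
    using kz by (simp_all add: convex_combination_def)
  \<comment> \<open>The combination for \<open>c\<close> is multiplied by \<open>n\<close>, so that
    its \<open>j z\<close> copies of \<open>n z\<close> can be replaced by their expansion over
    \<open>C\<close>.\<close>
  have "(\<Sum>x\<in>C. nmul (n * j x + j z * k x) x) = nmul (n * N) c"
  proof -
    have "(\<Sum>x\<in>C. nmul (n * j x + j z * k x) x)
        = nmul n (\<Sum>x\<in>C. nmul (j x) x) + nmul (j z) (nmul n z)"
      by (simp add: nmul_add_left nmul_mult sum.distrib flip: nmul_sum kn(2))
    also have "\<dots> = nmul n (nmul (j z) z + (\<Sum>x\<in>C. nmul (j x) x))"
      by (simp add: nmul_add_right add.commute mult.commute flip: nmul_mult)
    finally show ?thesis by (simp add: N nmul_mult)
  qed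
  moreover have "(\<Sum>x\<in>C. n * j x + j z * k x) = n * N"
    by (simp add: sum.distrib kn flip: sum_distrib_left N(1)) (simp add: algebra_simps)
  ultimately have "convex_combination C (n * N) (\<lambda>x. n * j x + j z * k x) c"
    by (simp add: convex_combination_def)
  then have 0: "n * j x + j z * k x = 0" if "x \<in> C - {c}" for x
    using c that unfolding extreme_point_def by blast
  have cC: "c \<in> C" using c by (simp add: extreme_point_def)
  \<comment> \<open>If \<open>z\<close> had positive weight, its own combination would be
    concentrated at \<open>c\<close>, giving \<open>n z = n c\<close> and, by torsion-freeness,
    \<open>z = c\<close>.\<close>
  have "j z = 0"
  proof (rule ccontr)
    assume "j z \<noteq> 0"
    with 0 have k0: "k x = 0" if "x \<in> C - {c}" for x using that by fastforce
    have "(\<Sum>x\<in>C. k x) = k c" "(\<Sum>x\<in>C. nmul (k x) x) = nmul (k c) c"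
      using \<open>finite C\<close> cC k0 by (simp_all add: sum.remove[of C c])
    with kn have "nmul n z = nmul n c" by simp
    then have "z = c" using tf n unfolding torsion_free_monoid_def nmul_def by blast
    with cC z show False by simp
  qed
  moreover have "j x = 0" if "x \<in> C - {c}" for x using 0[OF that] n by simp
  ultimately show "\<forall>x\<in>insert z C - {c}. j x = 0" by blast
qed

text \<open>A point that is a convex combination of the others can be discarded by induction; if
  there is no such point, every point is extreme.\<close>

lemma extreme_point_exists:
  fixes C :: "'g::comm_monoid_add set"
  assumes canc: "cancellative_monoid TYPE('g)" and tf: "torsion_free_monoid TYPE('g)"
    and "finite C" "C \<noteq> {}"
  shows "\<exists>c. extreme_point C c"
  using assms(3,4)
proof (induction C rule: finite_psubset_induct)
  case (psubset C)
  show ?case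
  proof (cases "\<exists>z\<in>C. \<exists>n k. n \<ge> 1 \<and> convex_combination (C - {z}) n k z")
    case True
    then obtain z n k where z: "z \<in> C" "n \<ge> 1" "convex_combination (C - {z}) n k z" by blast
    then have "C - {z} \<noteq> {}" by (metis convex_combination_def not_one_le_zero sum.empty)
    with psubset.IH[of "C - {z}"] z(1) obtain c where "extreme_point (C - {z}) c" by blast
    with extreme_point_insert[OF tf, of "C - {z}" z] z psubset.hyps show ?thesis
      by (auto simp: insert_absorb)
  next
    case False
    from \<open>C \<noteq> {}\<close> obtain z where z: "z \<in> C" by blast
    have "extreme_point C z"
      unfolding extreme_point_def
    proof (intro conjI allI impI)
      fix n k assume "convex_combination C n k z"
      then have k: "k z + (\<Sum>x\<in>C - {z}. k x) = n"
          "nmul (k z) z + (\<Sum>x\<in>C - {z}. nmul (k x) x) = nmul n z"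
        using z psubset.hyps by (simp_all add: convex_combination_def sum.remove[of C z])
      \<comment> \<open>Cancelling the \<open>k z\<close> copies of \<open>z\<close> leaves a
        combination of the other points of total weight \<open>r\<close>, which is possible only for
        \<open>r = 0\<close>.\<close>
      define r where "r = (\<Sum>x\<in>C - {z}. k x)"
      have "nmul (k z) z + (\<Sum>x\<in>C - {z}. nmul (k x) x) = nmul (k z) z + nmul r z"
        using k by (simp add: nmul_add_left[symmetric] r_def)
      with canc have "(\<Sum>x\<in>C - {z}. nmul (k x) x) = nmul r z"
        unfolding cancellative_monoid_def by blast
      then have "convex_combination (C - {z}) r k z"
        by (simp add: convex_combination_def r_def)
      with False z have "r = 0" by (metis not_one_le_zero less_one linorder_not_le)
      then show "\<forall>x\<in>C - {z}. k x = 0" using psubset.hyps by (simp add: r_def)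
    qed (fact z)
    then show ?thesis ..
  qed
qed

lemma unique_sum_exists:
  fixes A B :: "'g::comm_monoid_add set"
  assumes canc: "cancellative_monoid TYPE('g)" and tf: "torsion_free_monoid TYPE('g)"
    and A: "finite A" "A \<noteq> {}" and B: "finite B" "B \<noteq> {}"
  obtains a b where "a \<in> A" "b \<in> B"
    "\<And>a' b'. a' \<in> A \<Longrightarrow> b' \<in> B \<Longrightarrow> a' + b' = a + b \<Longrightarrow> a' = a \<and> b' = b"
proof -
  define C where "C = (\<lambda>(a, b). a + b) ` (A \<times> B)"
  have C: "finite C" "C \<noteq> {}" using A B by (auto simp: C_def)
  from extreme_point_exists[OF canc tf C] obtain c where c: "extreme_point C c" ..
  then obtain a b where ab: "a \<in> A" "b \<in> B" "c = a + b" by (auto simp: extreme_point_def C_def)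
  have "a' = a \<and> b' = b" if a'b': "a' \<in> A" "b' \<in> B" "a' + b' = a + b" for a' b'
  proof -
    define x y where "x = a + b'" and "y = a' + b"
    have xy: "x \<in> C" "y \<in> C" using ab a'b' by (auto simp: C_def x_def y_def)
    have sum: "x + y = nmul 2 c"
      using a'b'(3) by (simp add: numeral_2_eq_2 x_def y_def ab(3)) (metis add.assoc add.commute)
    \<comment> \<open>These weights exhibit \<open>c\<close> as the midpoint of \<open>x\<close> and
      \<open>y\<close>; if \<open>x = y\<close>, that point gets weight 2.\<close>
    define k :: "'g \<Rightarrow> nat" where "k z = (if z = x then 1 else 0) + (if z = y then 1 else 0)" for z
    have "nmul (k z) z = (if z = x then z else 0) + (if z = y then z else 0)" for z
      by (simp add: k_def)
    then have "convex_combination C 2 k c"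
      using C(1) xy by (simp add: convex_combination_def sum[symmetric] sum.distrib) (simp add: k_def sum.distrib)
    with c have "\<forall>z\<in>C - {c}. k z = 0" by (simp add: extreme_point_def)
    then have "x = c" "y = c" using xy unfolding k_def by (metis DiffI add_is_0 one_neq_zero singletonD)+
    then have "a + b' = a + b" "b + a' = b + a" by (simp_all add: x_def y_def ab(3) add.commute)
    with canc show ?thesis unfolding cancellative_monoid_def by blast
  qed
  with ab show ?thesis using that by blast
qed

section \<open>Ideals and prime ideals\<close>

lemma ideal_zero: "semiring_ideal I \<Longrightarrow> 0 \<in> I"
  unfolding semiring_ideal_def by (metis all_not_in_conv mult_zero_left)

lemma ideal_INT:
  assumes "\<And>i. i \<in> I \<Longrightarrow> semiring_ideal (J i)"
  shows "semiring_ideal (\<Inter>i\<in>I. J i)"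
proof -
  have "0 \<in> (\<Inter>i\<in>I. J i)" using assms ideal_zero by blast
  then show ?thesis using assms by (auto simp: semiring_ideal_def)
qed

lemma prime_ideal_one_notin: "semiring_prime_ideal P \<Longrightarrow> 1 \<notin> P"
  unfolding semiring_prime_ideal_def semiring_ideal_def by (metis UNIV_eq_I mult.right_neutral)

lemma prime_ideal_prod_notin:
  assumes "semiring_prime_ideal P" and "\<And>i. i \<in> I \<Longrightarrow> r i \<notin> P"
  shows "(\<Prod>i\<in>I. r i) \<notin> P"
  using assms(2)
proof (induction I rule: infinite_finite_induct)
  case (insert i I)
  then show ?case using assms(1) by (auto simp: semiring_prime_ideal_def)
qed (simp_all add: prime_ideal_one_notin[OF assms(1)])

lemma ideal_prod_mem:
  assumes "semiring_ideal P" "finite I" "i \<in> I" "r i \<in> P"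
  shows "(\<Prod>i\<in>I. r i) \<in> P"
proof -
  have "(\<Prod>i\<in>I. r i) = (\<Prod>i\<in>I - {i}. r i) * r i"
    using assms(2,3) by (simp add: prod.remove mult.commute)
  then show ?thesis using assms(1,4) by (auto simp: semiring_ideal_def)
qed

text \<open>Otherwise each \<open>J i\<close> has an element outside \<open>P\<close>. Their product
  lies in every \<open>J i\<close>, hence in \<open>P\<close>, against primality; for empty
  \<open>I\<close> it is 1.\<close>

lemma prime_ideal_eq_Inter:
  assumes P: "semiring_prime_ideal P" and "finite I" and "\<And>i. i \<in> I \<Longrightarrow> semiring_ideal (J i)"
    and eq: "P = (\<Inter>i\<in>I. J i)"
  obtains i where "i \<in> I" "P = J i"
proof (rule ccontr)
  assume "\<not> thesis"
  with that eq have "\<forall>i\<in>I. \<exists>r. r \<in> J i \<and> r \<notin> P" by blast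
  then obtain r where r: "\<And>i. i \<in> I \<Longrightarrow> r i \<in> J i \<and> r i \<notin> P" by metis
  have "(\<Prod>i\<in>I. r i) \<in> J i" if "i \<in> I" for i
    using ideal_prod_mem[OF assms(3)[OF that] assms(2) that] r[OF that] by blast
  then have "(\<Prod>i\<in>I. r i) \<in> P" unfolding eq by blast
  moreover have "(\<Prod>i\<in>I. r i) \<notin> P" by (rule prime_ideal_prod_notin[OF P]) (simp add: r)
  ultimately show False by simp
qed

text \<open>Ideals with this property are the k-ideals; it stands in for subtraction in prime
  avoidance and holds for annihilators.\<close>

definition subtractive :: "'s::comm_semiring_1 set \<Rightarrow> bool" where
  "subtractive P \<longleftrightarrow> (\<forall>a b. a \<in> P \<and> a + b \<in> P \<longrightarrow> b \<in> P)"

lemma prime_avoidance: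
  assumes I: "semiring_ideal I" and "finite \<P>"
    and "\<And>P. P \<in> \<P> \<Longrightarrow> semiring_prime_ideal P \<and> subtractive P"
    and "I \<subseteq> \<Union>\<P>"
  obtains P where "P \<in> \<P>" "I \<subseteq> P"
proof -
  have "\<exists>x\<in>I. \<forall>P\<in>\<P>. x \<notin> P" if "\<forall>P\<in>\<P>. \<not> I \<subseteq> P"
    using assms(2,3) that
  proof (induction \<P> rule: finite_induct)
    case empty
    then show ?case using I by (auto simp: semiring_ideal_def)
  next
    case (insert P \<P>)
    then obtain x where x: "x \<in> I" "\<And>Q. Q \<in> \<P> \<Longrightarrow> x \<notin> Q" by auto
    from insert.prems obtain y where y: "y \<in> I" "y \<notin> P" by auto
    have P: "semiring_prime_ideal P" "subtractive P" using insert.prems by auto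
    show ?case
    proof (cases "x \<in> P")
      case False
      with x show ?thesis by auto
    next
      case True
      \<comment> \<open>Primes contained in \<open>P\<close> are avoided by anything outside
        \<open>P\<close>. So \<open>t\<close> is chosen in all the remaining primes but not in
        \<open>P\<close>, and \<open>x + t * y\<close> avoids \<open>P\<close> because of
        \<open>t * y\<close> and those primes because of \<open>x\<close>.\<close>
      define \<Q> where "\<Q> = {Q \<in> \<P>. \<not> Q \<subseteq> P}"
      have "finite \<Q>" using insert.hyps by (simp add: \<Q>_def)
      have "\<forall>Q\<in>\<Q>. \<exists>r. r \<in> Q \<and> r \<notin> P" by (auto simp: \<Q>_def)
      then obtain r where r: "\<And>Q. Q \<in> \<Q> \<Longrightarrow> r Q \<in> Q \<and> r Q \<notin> P" by metis
      define t where "t = (\<Prod>Q\<in>\<Q>. r Q)"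
      have "t \<notin> P" unfolding t_def using r by (intro prime_ideal_prod_notin[OF P(1)]) auto
      then have "t * y \<notin> P" using P(1) y(2) unfolding semiring_prime_ideal_def by blast
      then have nP: "x + t * y \<notin> P" using P(2) True unfolding subtractive_def by blast
      have "x + t * y \<notin> Q" if Q: "Q \<in> \<P>" for Q
      proof (cases "Q \<subseteq> P")
        case True
        with nP show ?thesis by auto
      next
        case False
        have pQ: "semiring_ideal Q" "subtractive Q"
          using insert.prems Q by (auto simp: semiring_prime_ideal_def)
        have "t \<in> Q" unfolding t_def
          by (rule ideal_prod_mem[OF pQ(1) \<open>finite \<Q>\<close>, of Q]) (use False Q r in \<open>auto simp: \<Q>_def\<close>)
        then have "t * y \<in> Q" using pQ(1) by (metis semiring_ideal_def mult.commute)
        with pQ(2) x(2)[OF Q] show ?thesis by (metis subtractive_def add.commute)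
      qed
      moreover have "x + t * y \<in> I" using I x(1) y(1) by (auto simp: semiring_ideal_def)
      ultimately show ?thesis using nP by auto
    qed
  qed
  with assms(4) that show ?thesis by blast
qed

section \<open>Zero divisors on monoid semimodules\<close>

context semimodule
begin

lemma ideal_Ann: "semiring_ideal (Ann smul m)"
  unfolding semiring_ideal_def Ann_def
  by (auto simp: smul_add_left smul_mult smul_zero_right intro: exI[of _ 0] smul_zero_left)

lemma subtractive_Ann: "subtractive (Ann smul m)"
  by (auto simp: subtractive_def Ann_def smul_add_left)

lemma lookup_monoid_smul:
  "Poly_Mapping.lookup (monoid_smul smul f u) k =
     (\<Sum>(g, h)\<in>Poly_Mapping.keys f \<times> Poly_Mapping.keys u. if g + h = k then smul (Poly_Mapping.lookup f g) (Poly_Mapping.lookup u h) else 0)"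
  by (simp add: monoid_smul_def lookup_sum lookup_single when_def sum.cartesian_product case_prod_unfold)

text \<open>Uniqueness is asked only of pairs with nonzero product, so it can be checked on a
  smaller set of exponents than the support.\<close>

lemma lookup_monoid_smul_unique:
  assumes "\<And>g h. g + h = a + b \<Longrightarrow> smul (Poly_Mapping.lookup f g) (Poly_Mapping.lookup u h) \<noteq> 0 \<Longrightarrow> g = a \<and> h = b"
  shows "Poly_Mapping.lookup (monoid_smul smul f u) (a + b) = smul (Poly_Mapping.lookup f a) (Poly_Mapping.lookup u b)"
proof -
  have "Poly_Mapping.lookup (monoid_smul smul f u) (a + b) =
      (\<Sum>p\<in>Poly_Mapping.keys f \<times> Poly_Mapping.keys u. if p = (a, b) then smul (Poly_Mapping.lookup f a) (Poly_Mapping.lookup u b) else 0)"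
    unfolding lookup_monoid_smul using assms by (intro sum.cong) (auto split: if_splits)
  also have "\<dots> = smul (Poly_Mapping.lookup f a) (Poly_Mapping.lookup u b)"
    by (auto simp: sum.delta in_keys_iff smul_zero_left smul_zero_right)
  finally show ?thesis .
qed

lemma lookup_monoid_smul_const_left:
  "Poly_Mapping.lookup (monoid_smul smul (Poly_Mapping.single 0 s) u) h = smul s (Poly_Mapping.lookup u h)"
proof -
  have "g = 0 \<and> h' = h"
    if "g + h' = 0 + h" "smul (Poly_Mapping.lookup (Poly_Mapping.single 0 s) g) (Poly_Mapping.lookup u h') \<noteq> 0"
    for g h' using that by (cases "g = 0") (auto simp: lookup_single when_def smul_zero_left)
  from lookup_monoid_smul_unique[OF this] show ?thesis by simp
qed

lemma lookup_monoid_smul_const_right: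
  "Poly_Mapping.lookup (monoid_smul smul f (Poly_Mapping.single 0 m)) g = smul (Poly_Mapping.lookup f g) m"
proof -
  have "g' = g \<and> h = 0"
    if "g' + h = g + 0" "smul (Poly_Mapping.lookup f g') (Poly_Mapping.lookup (Poly_Mapping.single 0 m) h) \<noteq> 0"
    for g' h using that by (cases "h = 0") (auto simp: lookup_single when_def smul_zero_right)
  from lookup_monoid_smul_unique[OF this] show ?thesis by simp
qed

text \<open>For \<open>P = Ann smul m\<close> this exhibits the extension P[G] as an annihilator, as
  membership in \<open>Ass\<close> demands.\<close>

lemma Ann_const:
  "Ann (monoid_smul smul) (Poly_Mapping.single 0 m) = {f. \<forall>g. Poly_Mapping.lookup f g \<in> Ann smul m}"
  by (auto simp: Ann_def poly_mapping_eq_iff fun_eq_iff lookup_monoid_smul_const_right)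

text \<open>Constants act coefficientwise, and coefficients outside the support are zero, so only
  the finitely many exponents in the support impose a condition.\<close>

lemma contraction_Ann:
  "{s. Poly_Mapping.single 0 s \<in> Ann (monoid_smul smul) u} = (\<Inter>h\<in>Poly_Mapping.keys u. Ann smul (Poly_Mapping.lookup u h))"
  by (auto simp: Ann_def poly_mapping_eq_iff fun_eq_iff lookup_monoid_smul_const_left)
    (metis in_keys_iff smul_zero_right)

lemma prime_Ann_const:
  assumes canc: "cancellative_monoid TYPE('g::comm_monoid_add)"
    and tf: "torsion_free_monoid TYPE('g)"
    and P: "semiring_prime_ideal (Ann smul m)"
  shows "semiring_prime_ideal
    (Ann (monoid_smul smul :: ('g \<Rightarrow>\<^sub>0 _) \<Rightarrow> _) (Poly_Mapping.single 0 m))" (is "semiring_prime_ideal ?P")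
  unfolding semiring_prime_ideal_def
proof (intro conjI allI impI)
  show "semiring_ideal ?P"
    by (rule semimodule.ideal_Ann[OF semimodule_monoid_smul])
  have "(1 :: 'g \<Rightarrow>\<^sub>0 _) \<notin> ?P"
    unfolding Ann_const using prime_ideal_one_notin[OF P] by (auto simp: lookup_one intro!: exI[of _ 0])
  then show "?P \<noteq> UNIV" by blast
  fix f f' :: "'g \<Rightarrow>\<^sub>0 _"
  define v where "v = monoid_smul smul f' (Poly_Mapping.single 0 m)"
  assume "f * f' \<in> ?P"
  then have fv: "monoid_smul smul f v = 0"
    by (simp add: Ann_def v_def monoid_smul_mult)
  have v: "Poly_Mapping.lookup v h = smul (Poly_Mapping.lookup f' h) m" for h
    by (simp add: v_def lookup_monoid_smul_const_right)
  show "f \<in> ?P \<or> f' \<in> ?P"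
  proof (rule ccontr)
    assume *: "\<not> ?thesis"
    \<comment> \<open>Coefficients of \<open>f\<close> that annihilate \<open>m\<close> also kill
      all coefficients of \<open>v\<close>, which are multiples of \<open>m\<close>; only the
      exponents in \<open>A\<close> contribute to the product.\<close>
    define A where "A = {g. Poly_Mapping.lookup f g \<notin> Ann smul m}"
    have "A \<subseteq> Poly_Mapping.keys f" by (auto simp: A_def in_keys_iff Ann_def smul_zero_left)
    then have A: "finite A" by (rule finite_subset) simp
    have "A \<noteq> {}" using * by (auto simp: A_def Ann_const)
    moreover have "Poly_Mapping.keys v \<noteq> {}"
      using * by (auto simp: Ann_def v_def)
    ultimately obtain a b where ab: "a \<in> A" "b \<in> Poly_Mapping.keys v"
      "\<And>a' b'. a' \<in> A \<Longrightarrow> b' \<in> Poly_Mapping.keys v \<Longrightarrow> a' + b' = a + b \<Longrightarrow> a' = a \<and> b' = b"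
      using unique_sum_exists[OF canc tf A _ finite_keys] by metis
    have "smul (Poly_Mapping.lookup f g) (Poly_Mapping.lookup v h) = 0" if "g \<notin> A \<or> h \<notin> Poly_Mapping.keys v" for g h
    proof (cases "h \<in> Poly_Mapping.keys v")
      case True
      with that have "smul (Poly_Mapping.lookup f g) m = 0" by (simp add: A_def Ann_def)
      then show ?thesis by (simp add: v smul_mult[symmetric] mult.commute[of "Poly_Mapping.lookup f g"])
        (simp add: smul_mult smul_zero_right)
    qed (simp add: in_keys_iff smul_zero_right)
    then have "Poly_Mapping.lookup (monoid_smul smul f v) (a + b) = smul (Poly_Mapping.lookup f a) (Poly_Mapping.lookup v b)"
      using ab(3) by (intro lookup_monoid_smul_unique) blast
    then have "Poly_Mapping.lookup f a * Poly_Mapping.lookup f' b \<in> Ann smul m"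
      by (simp add: fv v Ann_def smul_mult)
    moreover have "Poly_Mapping.lookup f' b \<notin> Ann smul m"
      using ab(2) by (simp add: in_keys_iff v Ann_def)
    ultimately show False using ab(1) P by (auto simp: semiring_prime_ideal_def A_def)
  qed
qed

text \<open>
  McCoy's theorem: if \<open>u\<close> has minimal support among the nonzero elements annihilated by \<open>f\<close>, then
  every coefficient of \<open>f\<close> already annihilates \<open>u\<close>, for otherwise multiplying \<open>u\<close> by a suitable
  coefficient of \<open>f\<close> would shrink its support.
\<close>

lemma coefficients_annihilate:
  fixes f :: "'g::comm_monoid_add \<Rightarrow>\<^sub>0 's"
  assumes canc: "cancellative_monoid TYPE('g)"
    and tf: "torsion_free_monoid TYPE('g)"
    and f: "monoid_smul smul f u = 0" and u: "u \<noteq> 0"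
  obtains m where "m \<noteq> 0" "\<And>g. smul (Poly_Mapping.lookup f g) m = 0"
proof -
  define w where "w = arg_min (\<lambda>v. card (Poly_Mapping.keys v)) (\<lambda>v. monoid_smul smul f v = 0 \<and> v \<noteq> 0)"
  have "monoid_smul smul f w = 0 \<and> w \<noteq> 0"
    unfolding w_def by (rule arg_min_natI[of _ u]) (use f u in simp)
  then have w: "monoid_smul smul f w = 0" "w \<noteq> 0" by auto
  have w_min: "card (Poly_Mapping.keys w) \<le> card (Poly_Mapping.keys v)" if "monoid_smul smul f v = 0" "v \<noteq> 0" for v
    unfolding w_def by (rule arg_min_nat_le) (use that in simp)
  \<comment> \<open>By commutativity the multiple of \<open>w\<close> by a coefficient of
    \<open>f\<close> is again annihilated by \<open>f\<close>. Losing the exponent \<open>b\<close>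
    makes its support strictly smaller, so it must be zero.\<close>
  have kill: "monoid_smul smul (Poly_Mapping.single 0 (Poly_Mapping.lookup f a)) w = 0"
    if b: "b \<in> Poly_Mapping.keys w" "smul (Poly_Mapping.lookup f a) (Poly_Mapping.lookup w b) = 0" for a b
  proof (rule ccontr)
    let ?v = "monoid_smul smul (Poly_Mapping.single 0 (Poly_Mapping.lookup f a)) w"
    assume "?v \<noteq> 0"
    moreover have "monoid_smul smul f ?v = 0"
      by (metis monoid_smul_mult mult.commute w(1) monoid_smul_zero(2))
    ultimately have "card (Poly_Mapping.keys w) \<le> card (Poly_Mapping.keys ?v)" by (rule w_min[rotated])
    moreover have "Poly_Mapping.keys ?v \<subset> Poly_Mapping.keys w"
      using b by (auto simp: in_keys_iff lookup_monoid_smul_const_left smul_zero_right)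
    ultimately show False by (metis finite_keys psubset_card_mono leD)
  qed
  \<comment> \<open>The induction runs over \<open>f\<close> with some terms deleted: nonzero
    coefficients of \<open>f'\<close> stay coefficients of \<open>f\<close>, so \<open>kill\<close>
    still applies.\<close>
  have all: "\<forall>g. monoid_smul smul (Poly_Mapping.single 0 (Poly_Mapping.lookup f' g)) w = 0"
    if "monoid_smul smul f' w = 0" "\<forall>g. Poly_Mapping.lookup f' g = Poly_Mapping.lookup f g \<or> Poly_Mapping.lookup f' g = 0" for f'
    using that
  proof (induction "card (Poly_Mapping.keys f')" arbitrary: f' rule: less_induct)
    case less
    show ?case
    proof (cases "f' = 0")
      case False
      then obtain a b where ab: "a \<in> Poly_Mapping.keys f'" "b \<in> Poly_Mapping.keys w"
        "\<And>a' b'. a' \<in> Poly_Mapping.keys f' \<Longrightarrow> b' \<in> Poly_Mapping.keys w \<Longrightarrow> a' + b' = a + b \<Longrightarrow> a' = a \<and> b' = b"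
        using unique_sum_exists[OF canc tf finite_keys _ finite_keys, of f' w] w(2)
        by (metis keys_eq_empty)
      have "Poly_Mapping.lookup (monoid_smul smul f' w) (a + b) = smul (Poly_Mapping.lookup f' a) (Poly_Mapping.lookup w b)"
        by (rule lookup_monoid_smul_unique)
          (metis ab(3) in_keys_iff smul_zero_left smul_zero_right)
      then have 0: "smul (Poly_Mapping.lookup f' a) (Poly_Mapping.lookup w b) = 0" by (simp add: less.prems)
      have fa: "Poly_Mapping.lookup f' a = Poly_Mapping.lookup f a" using ab(1) less.prems(2) by (metis in_keys_iff)
      have a0: "monoid_smul smul (Poly_Mapping.single 0 (Poly_Mapping.lookup f' a)) w = 0"
        using kill[OF ab(2)] 0 fa by simp
      define f'' where "f'' = Poly_Mapping.update a 0 f'"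
      have f'': "Poly_Mapping.lookup f'' g = (if g = a then 0 else Poly_Mapping.lookup f' g)" for g
        by (simp add: f''_def lookup_update)
      have split: "f' = Poly_Mapping.single a (Poly_Mapping.lookup f' a) + f''"
        by (rule poly_mapping_eqI) (simp add: lookup_add lookup_single f'' when_def)
      \<comment> \<open>The whole term at \<open>a\<close> annihilates \<open>w\<close> because its
        constant factor does, so deleting it leaves an annihilator of \<open>w\<close>.\<close>
      have "Poly_Mapping.single a (Poly_Mapping.lookup f' a) = Poly_Mapping.single a 1 * Poly_Mapping.single 0 (Poly_Mapping.lookup f' a)"
        by (simp add: mult_single)
      then have "monoid_smul smul (Poly_Mapping.single a (Poly_Mapping.lookup f' a)) w = 0"
        by (simp only: monoid_smul_mult a0 monoid_smul_zero)
      then have "monoid_smul smul f'' w = 0"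
        using less.prems(1) by (subst (asm) split) (simp add: monoid_smul_add_left)
      moreover have "Poly_Mapping.keys f'' \<subset> Poly_Mapping.keys f'"
        using ab(1) by (auto simp: in_keys_iff f'' split: if_splits)
      ultimately have "\<forall>g. monoid_smul smul (Poly_Mapping.single 0 (Poly_Mapping.lookup f'' g)) w = 0"
        using less.prems(2) by (intro less.hyps) (auto simp: psubset_card_mono f'')
      then show ?thesis using a0 by (metis f'')
    qed (simp add: monoid_smul_zero)
  qed
  from w(2) obtain h where h: "Poly_Mapping.lookup w h \<noteq> 0"
    by (auto simp: poly_mapping_eq_iff fun_eq_iff)
  moreover have "smul (Poly_Mapping.lookup f g) (Poly_Mapping.lookup w h) = 0" for g
    using all[OF w(1)] by (simp flip: lookup_monoid_smul_const_left)
  ultimately show ?thesis using that by blast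
qed

section \<open>Passing between the zero divisors of M and of M[G]\<close>

lemma zero_divisors_contraction:
  "zero_divisors smul =
     {s. Poly_Mapping.single 0 s \<in> zero_divisors (monoid_smul smul :: ('g::comm_monoid_add \<Rightarrow>\<^sub>0 's) \<Rightarrow> _)}"
proof (intro set_eqI iffI CollectI)
  fix s assume "s \<in> zero_divisors smul"
  then obtain m where m: "m \<noteq> 0" "smul s m = 0" by (auto simp: zero_divisors_def)
  then have "monoid_smul smul (Poly_Mapping.single (0::'g) s) (Poly_Mapping.single 0 m) = 0"
    by (simp add: monoid_smul_single)
  moreover have "Poly_Mapping.single (0::'g) m \<noteq> 0" using m(1) by (metis lookup_single_eq lookup_zero)
  ultimately show "Poly_Mapping.single (0::'g) s \<in> zero_divisors (monoid_smul smul)"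
    unfolding zero_divisors_def by blast
next
  fix s assume "s \<in> {s. Poly_Mapping.single (0::'g) s \<in> zero_divisors (monoid_smul smul)}"
  then obtain u :: "'g \<Rightarrow>\<^sub>0 'm" where u: "u \<noteq> 0" "monoid_smul smul (Poly_Mapping.single 0 s) u = 0"
    by (auto simp: zero_divisors_def)
  then obtain h where "Poly_Mapping.lookup u h \<noteq> 0" by (auto simp: poly_mapping_eq_iff fun_eq_iff)
  moreover have "smul s (Poly_Mapping.lookup u h) = 0"
    using u(2) by (simp flip: lookup_monoid_smul_const_left)
  ultimately show "s \<in> zero_divisors smul" by (auto simp: zero_divisors_def)
qed

lemma very_few_zero_divisors_contraction:
  assumes "very_few_zero_divisors (monoid_smul smul :: ('g::comm_monoid_add \<Rightarrow>\<^sub>0 's) \<Rightarrow> _)"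
  shows "very_few_zero_divisors smul"
proof -
  let ?smul = "monoid_smul smul :: ('g \<Rightarrow>\<^sub>0 's) \<Rightarrow> _"
  from assms obtain \<Q> where \<Q>: "finite \<Q>" "\<Q> \<subseteq> Ass ?smul" "zero_divisors ?smul = \<Union>\<Q>"
    by (auto simp: very_few_zero_divisors_def)
  \<comment> \<open>Contraction along the embedding of S into S[G] as constants; it commutes with
    unions.\<close>
  let ?R = "\<lambda>Q :: ('g \<Rightarrow>\<^sub>0 's) set. {s. Poly_Mapping.single 0 s \<in> Q}"
  have "?R Q \<in> Ass smul" if "Q \<in> \<Q>" for Q
  proof -
    from that \<Q>(2) obtain u where Q: "semiring_prime_ideal Q" "Q = Ann ?smul u"
      by (auto simp: Ass_def)
    have RQ: "?R Q = (\<Inter>h\<in>Poly_Mapping.keys u. Ann smul (Poly_Mapping.lookup u h))"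
      unfolding Q(2) by (rule contraction_Ann)
    have "semiring_prime_ideal (?R Q)"
      unfolding semiring_prime_ideal_def
    proof (intro conjI allI impI)
      show "semiring_ideal (?R Q)"
        unfolding RQ by (intro ideal_INT ideal_Ann)
      have "1 \<notin> ?R Q" using prime_ideal_one_notin[OF Q(1)] by simp
      then show "?R Q \<noteq> UNIV" by blast
      fix a b assume "a * b \<in> ?R Q"
      then have "Poly_Mapping.single 0 a * Poly_Mapping.single 0 b \<in> Q" by (simp add: mult_single)
      then show "a \<in> ?R Q \<or> b \<in> ?R Q" using Q(1) by (auto simp: semiring_prime_ideal_def)
    qed
    moreover from prime_ideal_eq_Inter[OF this finite_keys ideal_Ann RQ]
    obtain h where "?R Q = Ann smul (Poly_Mapping.lookup u h)" by metis
    ultimately show ?thesis by (auto simp: Ass_def)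
  qed
  moreover have "zero_divisors smul = \<Union>(?R ` \<Q>)"
    unfolding zero_divisors_contraction[where 'g = 'g] \<Q>(3) by blast
  ultimately show ?thesis
    unfolding very_few_zero_divisors_def using \<Q>(1) by (intro exI[of _ "?R ` \<Q>"]) auto
qed

lemma very_few_zero_divisors_extension:
  assumes canc: "cancellative_monoid TYPE('g::comm_monoid_add)"
    and tf: "torsion_free_monoid TYPE('g)"
    and "very_few_zero_divisors smul"
  shows "very_few_zero_divisors (monoid_smul smul :: ('g \<Rightarrow>\<^sub>0 's) \<Rightarrow> _)"
proof -
  let ?smul = "monoid_smul smul :: ('g \<Rightarrow>\<^sub>0 's) \<Rightarrow> _"
  from assms obtain \<P> where \<P>: "finite \<P>" "\<P> \<subseteq> Ass smul" "zero_divisors smul = \<Union>\<P>"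
    by (auto simp: very_few_zero_divisors_def)
  \<comment> \<open>This is the extension P[G].\<close>
  let ?E = "\<lambda>P. {f :: 'g \<Rightarrow>\<^sub>0 's. \<forall>g. Poly_Mapping.lookup f g \<in> P}"
  have E_Ann: "\<exists>m. P = Ann smul m \<and> ?E P = Ann ?smul (Poly_Mapping.single 0 m)" if "P \<in> \<P>" for P
    using that \<P>(2) by (auto simp: Ass_def Ann_const)
  have "?E P \<in> Ass ?smul" if "P \<in> \<P>" for P
    using that \<P>(2) E_Ann[OF that] prime_Ann_const[OF canc tf] by (auto simp: Ass_def)
  moreover have "zero_divisors ?smul = \<Union>(?E ` \<P>)"
  proof (intro set_eqI iffI)
    fix f assume "f \<in> zero_divisors ?smul"
    then obtain u where "u \<noteq> 0" "?smul f u = 0" by (auto simp: zero_divisors_def)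
    with coefficients_annihilate[OF canc tf] obtain m
      where m: "m \<noteq> 0" "\<And>g. smul (Poly_Mapping.lookup f g) m = 0" by metis
    have "Ann smul m \<subseteq> \<Union>\<P>"
      unfolding \<P>(3)[symmetric] using m(1) by (auto simp: Ann_def zero_divisors_def)
    moreover have "semiring_prime_ideal P \<and> subtractive P" if "P \<in> \<P>" for P
      using that \<P>(2) subtractive_Ann by (auto simp: Ass_def)
    \<comment> \<open>A single prime must contain all coefficients of \<open>f\<close> at once; a
      cover of them by several primes would not place \<open>f\<close> in one P[G].\<close>
    ultimately obtain P where "P \<in> \<P>" "Ann smul m \<subseteq> P"
      using prime_avoidance[OF ideal_Ann \<P>(1)] by metis
    with m(2) show "f \<in> \<Union>(?E ` \<P>)" by (auto simp: Ann_def)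
  next
    fix f assume "f \<in> \<Union>(?E ` \<P>)"
    then obtain P where P: "P \<in> \<P>" "f \<in> ?E P" by blast
    from E_Ann[OF P(1)] obtain m where m: "P = Ann smul m" "?E P = Ann ?smul (Poly_Mapping.single 0 m)" by blast
    \<comment> \<open>The annihilator of 0 is all of S, whereas a prime ideal is proper.\<close>
    have "m \<noteq> 0"
      using P(1) \<P>(2) m(1) by (auto simp: Ass_def semiring_prime_ideal_def Ann_def smul_zero_right)
    then have "Poly_Mapping.single (0::'g) m \<noteq> 0" by (metis lookup_single_eq lookup_zero)
    with P(2) m(2) show "f \<in> zero_divisors ?smul" by (auto simp: zero_divisors_def Ann_def)
  qed
  ultimately show ?thesis
    unfolding very_few_zero_divisors_def using \<P>(1) by (intro exI[of _ "?E ` \<P>"]) auto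
qed

end

theorem theorem2p18:
  fixes smul :: "'s::comm_semiring_1 \<Rightarrow> 'm::comm_monoid_add \<Rightarrow> 'm"
  assumes "semimodule smul"
    and "\<exists>m::'m. m \<noteq> 0"
    and "cancellative_monoid TYPE('g::comm_monoid_add)"
    and "torsion_free_monoid TYPE('g)"
  shows "very_few_zero_divisors
           (monoid_smul smul :: ('g \<Rightarrow>\<^sub>0 's) \<Rightarrow> ('g \<Rightarrow>\<^sub>0 'm) \<Rightarrow> ('g \<Rightarrow>\<^sub>0 'm))
         \<longleftrightarrow> very_few_zero_divisors smul"
  using semimodule.very_few_zero_divisors_contraction[OF assms(1)]
    semimodule.very_few_zero_divisors_extension[OF assms(1,3,4)] by blast

end
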